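(* Let $n\ge 2$, $m\ge 1$ and $d\in\{1,\dots,n-1\}$ be integers. In the fully anonymous read-write (RW) communication model with $n$ processes and $m$ registers, there is neither a $d$-election algorithm nor an exact $d$-election algorithm, whether participation of all the processes is required or not.
   Context: System. There are $n$ asynchronous deterministic processes $p_1,\dots,p_n$ and $m$ shared atomic registers. An execution is an interleaving of atomic steps; in each step one process performs one operation on one register and updates its local state. Processes do not crash: every participating process that has not yet returned keeps taking steps; otherwise the interleaving is arbitrary. Algorithms may depend on $n,m,d$. RW registers. The only operations on a register are atomic read and atomic write. Full anonymity. The processes have no identities, run the same code and have the same initial local state (the subscript $i$ is only an external notation). The memory is anonymous: an adversary chooses, for each process $p_i$, a permutation $f_i$ of $\{1,\dots,m\}$, unknown to all the processes; when $p_i$ uses the name $R[x]$ it accesses the register $R[f_i(x)]$. All registers have the same initial value. Election. Each participating process invokes $\mathsf{elect}()$ (once), which returns either "leader" or "not leader"; a process that returns "leader" is elected. An algorithm solves $d$-election (respectively, exact $d$-election) if in every execution, for every choice of the permutations $f_i$, every participating process eventually returns, and at least one and at most $d$ processes are elected (respectively, exactly $d$ processes are elected). "Participation required" means that only executions in which all $n$ processes participate are considered; "participation not required" means that the condition must hold for every nonempty subset of the processes as the set of participating processes. *)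

theory Defs
  imports "HOL-Combinatorics.Permutations"
begin

datatype verdict = Leader | Not_Leader

text \<open>
  What a process does next is determined by its local state: read the register it calls \<open>R[x]\<close> and
  continue in a local state depending on the value read, write a value to the register it calls
  \<open>R[x]\<close> and continue in a given local state, or (having returned) nothing.
\<close>

datatype ('s, 'v) action =
    Read nat "'v \<Rightarrow> 's"
  | Write nat 'v 's
  | Return verdict

text \<open>
  No component of an algorithm mentions a process, so all processes run the same code from the same
  initial state.
\<close>

record ('s, 'v) algorithm =
  init_state :: 's
  init_value :: 'v
  program :: "'s \<Rightarrow> ('s, 'v) action"

definition uses_registers :: "nat \<Rightarrow> ('s, 'v) algorithm \<Rightarrow> bool" where
  "uses_registers m A \<longleftrightarrow>
     (\<forall>s. case program A s of Read x g \<Rightarrow> x \<in> {1..m}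
                            | Write x v s' \<Rightarrow> x \<in> {1..m}
                            | Return r \<Rightarrow> True)"

record ('s, 'v) config =
  local_state :: "nat \<Rightarrow> 's"
  register :: "nat \<Rightarrow> 'v"

definition init_config :: "('s, 'v) algorithm \<Rightarrow> ('s, 'v) config" where
  "init_config A = \<lparr>local_state = (\<lambda>p. init_state A), register = (\<lambda>y. init_value A)\<rparr>"

text \<open>
  \<open>f p\<close> is the permutation of the register names given to process \<open>p\<close>. A process that has returned
  takes no further steps: scheduling it leaves the configuration unchanged, which also lets an
  infinite schedule represent an execution with only finitely many steps.
\<close>

definition step ::
  "('s, 'v) algorithm \<Rightarrow> (nat \<Rightarrow> nat \<Rightarrow> nat) \<Rightarrow> nat \<Rightarrow> ('s, 'v) config \<Rightarrow> ('s, 'v) config" where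
  "step A f p c =
     (case program A (local_state c p) of
        Read x g \<Rightarrow> c\<lparr>local_state := (local_state c)(p := g (register c (f p x)))\<rparr>
      | Write x v s \<Rightarrow> c\<lparr>local_state := (local_state c)(p := s),
                        register := (register c)(f p x := v)\<rparr>
      | Return r \<Rightarrow> c)"

primrec run ::
  "('s, 'v) algorithm \<Rightarrow> (nat \<Rightarrow> nat \<Rightarrow> nat) \<Rightarrow> (nat \<Rightarrow> nat) \<Rightarrow> nat \<Rightarrow> ('s, 'v) config" where
  "run A f \<sigma> 0 = init_config A"
| "run A f \<sigma> (Suc k) = step A f (\<sigma> k) (run A f \<sigma> k)"

definition returned :: "('s, 'v) algorithm \<Rightarrow> ('s, 'v) config \<Rightarrow> nat \<Rightarrow> verdict \<Rightarrow> bool" where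
  "returned A c p r \<longleftrightarrow> program A (local_state c p) = Return r"

text \<open>
  Schedules of the executions with participating set \<open>P\<close>: participants do not crash, hence each of
  them keeps being scheduled as long as it has not returned.
\<close>

definition admissible ::
  "('s, 'v) algorithm \<Rightarrow> (nat \<Rightarrow> nat \<Rightarrow> nat) \<Rightarrow> nat set \<Rightarrow> (nat \<Rightarrow> nat) \<Rightarrow> bool" where
  "admissible A f P \<sigma> \<longleftrightarrow>
     (\<forall>k. \<sigma> k \<in> P) \<and>
     (\<forall>p\<in>P. \<forall>k. (\<forall>r. \<not> returned A (run A f \<sigma> k) p r) \<longrightarrow> (\<exists>j\<ge>k. \<sigma> j = p))"

definition elected ::
  "('s, 'v) algorithm \<Rightarrow> (nat \<Rightarrow> nat \<Rightarrow> nat) \<Rightarrow> nat set \<Rightarrow> (nat \<Rightarrow> nat) \<Rightarrow> nat set" where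
  "elected A f P \<sigma> = {p \<in> P. \<exists>k. returned A (run A f \<sigma> k) p Leader}"

datatype participation = Required | Not_Required

fun participant_sets :: "nat \<Rightarrow> participation \<Rightarrow> nat set set" where
  "participant_sets n Required = {{1..n}}"
| "participant_sets n Not_Required = {P. P \<subseteq> {1..n} \<and> P \<noteq> {}}"

text \<open>\<open>K\<close> is the set of allowed numbers of elected processes.\<close>

definition solves_election ::
  "nat \<Rightarrow> nat \<Rightarrow> nat set \<Rightarrow> participation \<Rightarrow> ('s, 'v) algorithm \<Rightarrow> bool" where
  "solves_election n m K part A \<longleftrightarrow>
     uses_registers m A \<and>
     (\<forall>P \<in> participant_sets n part. \<forall>f \<sigma>.
        (\<forall>p\<in>{1..n}. f p permutes {1..m}) \<and> admissible A f P \<sigma> \<longrightarrow>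
          (\<forall>p\<in>P. \<exists>k r. returned A (run A f \<sigma> k) p r) \<and>
          card (elected A f P \<sigma>) \<in> K)"

definition d_election_algorithm ::
  "nat \<Rightarrow> nat \<Rightarrow> nat \<Rightarrow> participation \<Rightarrow> ('s, 'v) algorithm \<Rightarrow> bool" where
  "d_election_algorithm n m d part A \<longleftrightarrow> solves_election n m {1..d} part A"

definition exact_d_election_algorithm ::
  "nat \<Rightarrow> nat \<Rightarrow> nat \<Rightarrow> participation \<Rightarrow> ('s, 'v) algorithm \<Rightarrow> bool" where
  "exact_d_election_algorithm n m d part A \<longleftrightarrow> solves_election n m {d} part A"

end

theory Submission
  imports Defs
begin

text \<open>
  Give all processes the same register permutation and schedule them in rounds. Within one round
  all processes perform the same operation on the same register: reads leave the memory unchanged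
  and repeating a write has no further effect. Hence after every round all processes are in the
  local state that a single process running alone would have reached, so either all \<open>n\<close> processes
  are elected or none is.
\<close>

definition round_robin :: "nat \<Rightarrow> nat \<Rightarrow> nat" where
  "round_robin n k = Suc (k mod n)"

text \<open>Reference run: with common code and a common naming of the registers, process 1 alone
  stands for any of them.\<close>

abbreviation solo ::
  "('s, 'v) algorithm \<Rightarrow> (nat \<Rightarrow> nat) \<Rightarrow> nat \<Rightarrow> ('s, 'v) config" where
  "solo A \<pi> k \<equiv> run A (\<lambda>_. \<pi>) (\<lambda>_. 1) k"

lemma admissible_round_robin:
  assumes "n > 0"
  shows "admissible A f {1..n} (round_robin n)"
  unfolding admissible_def
proof (intro conjI ballI allI impI)
  fix k
  show "round_robin n k \<in> {1..n}"
    using assms by (simp add: round_robin_def Suc_le_eq)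
next
  fix p k
  assume p: "p \<in> {1..n}"
  \<comment> \<open>The witness is the slot of \<open>p\<close> in round \<open>k\<close>, counted
    from 0.\<close>
  have "k \<le> k * n + (p - 1)"
    using assms by (cases n) auto
  moreover have "round_robin n (k * n + (p - 1)) = p"
    using p by (cases p) (auto simp: round_robin_def)
  ultimately show "\<exists>j\<ge>k. round_robin n j = p"
    by blast
qed

text \<open>Invariant inside a round: after \<open>j\<close> turns, processes up to \<open>j\<close>
  are one solo step ahead of the others, while the memory has already advanced at the first
  turn.\<close>

lemma run_within_round:
  assumes start: "\<forall>p\<in>{1..n}. local_state (run A (\<lambda>_. \<pi>) (round_robin n) (k * n)) p =
                    local_state (solo A \<pi> k) 1"
    and start_reg: "register (run A (\<lambda>_. \<pi>) (round_robin n) (k * n)) = register (solo A \<pi> k)"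
    and "j \<le> n"
  shows "(\<forall>p\<in>{1..n}. local_state (run A (\<lambda>_. \<pi>) (round_robin n) (k * n + j)) p =
            local_state (solo A \<pi> (if p \<le> j then Suc k else k)) 1) \<and>
         register (run A (\<lambda>_. \<pi>) (round_robin n) (k * n + j)) =
           register (solo A \<pi> (if j = 0 then k else Suc k))"
  using \<open>j \<le> n\<close>
proof (induction j)
  case 0
  then show ?case
    using start start_reg by simp
next
  case (Suc j)
  let ?c = "run A (\<lambda>_. \<pi>) (round_robin n) (k * n + j)"
  have sched: "round_robin n (k * n + j) = Suc j"
    using Suc.prems by (simp add: round_robin_def)
  have states: "\<forall>p\<in>{1..n}. local_state ?c p =
      local_state (solo A \<pi> (if p \<le> j then Suc k else k)) 1"
    and reg: "register ?c = register (solo A \<pi> (if j = 0 then k else Suc k))"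
    using Suc by simp_all
  have state: "local_state ?c (Suc j) = local_state (solo A \<pi> k) 1"
    using states Suc.prems by auto
  have next_c: "run A (\<lambda>_. \<pi>) (round_robin n) (k * n + Suc j) = step A (\<lambda>_. \<pi>) (Suc j) ?c"
    by (simp add: sched)
  \<comment> \<open>If the common action is a read, the memories of solo steps \<open>k\<close> and
    \<open>Suc k\<close> agree, so late readers see the same value; a late write stores what is
    already there.\<close>
  show ?case
    unfolding next_c using states reg state
    by (cases "program A (local_state (solo A \<pi> k) 1)")
      (auto simp: step_def le_Suc_eq split: if_splits)
qed

lemma run_at_round:
  assumes "n > 0"
  shows "(\<forall>p\<in>{1..n}. local_state (run A (\<lambda>_. \<pi>) (round_robin n) (k * n)) p =
            local_state (solo A \<pi> k) 1) \<and>
         register (run A (\<lambda>_. \<pi>) (round_robin n) (k * n)) = register (solo A \<pi> k)"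
proof (induction k)
  case 0
  then show ?case
    by (simp add: init_config_def)
next
  case (Suc k)
  then show ?case
    \<comment> \<open>At \<open>j = n\<close> the round is complete and everyone has caught
      up.\<close>
    using run_within_round[OF conjunct1[OF Suc] conjunct2[OF Suc], of n] assms
    by (simp add: add.commute del: run.simps)
qed

lemma elected_round_robin:
  assumes "n > 0"
  shows "elected A (\<lambda>_. \<pi>) {1..n} (round_robin n) \<in> {{}, {1..n}}"
proof -
  let ?run = "run A (\<lambda>_. \<pi>) (round_robin n)"
  have "q \<in> elected A (\<lambda>_. \<pi>) {1..n} (round_robin n)"
    if p: "p \<in> {1..n}" "returned A (?run t) p Leader" and q: "q \<in> {1..n}" for p q t
  proof -
    \<comment> \<open>Time \<open>t\<close> may fall inside a round, but the state of
      \<open>p\<close> is still a solo state, which \<open>q\<close> has at the start of some round,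
      possibly after \<open>t\<close>.\<close>
    have "local_state (?run (t div n * n + t mod n)) p =
        local_state (solo A \<pi> (if p \<le> t mod n then Suc (t div n) else t div n)) 1"
      using run_within_round[of n A \<pi> "t div n" "t mod n"]
        run_at_round[OF assms, of A \<pi> "t div n"] assms p(1)
      by (simp del: run.simps)
    then obtain k where "local_state (?run t) p = local_state (solo A \<pi> k) 1"
      by (metis div_mult_mod_eq)
    also have "\<dots> = local_state (?run (k * n)) q"
      using run_at_round[OF assms] q by metis
    finally have "returned A (?run (k * n)) q Leader"
      using p(2) by (simp add: returned_def)
    with q show ?thesis
      by (auto simp: elected_def)
  qed
  then show ?thesis
    by (auto simp: elected_def)
qed

lemma not_solves_election:
  assumes "n > 0" and "0 \<notin> K" and "n \<notin> K"
  shows "\<not> solves_election n m K part A"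
proof
  assume "solves_election n m K part A"
  \<comment> \<open>Full participation is allowed in both modes, so one execution refutes
    both.\<close>
  moreover have "{1..n} \<in> participant_sets n part"
    using assms(1) by (cases part) auto
  ultimately have "card (elected A (\<lambda>_. id) {1..n} (round_robin n)) \<in> K"
    using admissible_round_robin[OF assms(1)] permutes_id
    unfolding solves_election_def by metis
  then show False
    using elected_round_robin[OF assms(1), of A id] assms by auto
qed

theorem corollary2:
  fixes n m d :: nat and part :: participation
  assumes "n \<ge> 2" and "m \<ge> 1" and "d \<in> {1..n - 1}"
  shows "(\<nexists>A :: ('s, 'v) algorithm. d_election_algorithm n m d part A) \<and>
         (\<nexists>A :: ('s, 'v) algorithm. exact_d_election_algorithm n m d part A)"
  using assms
  by (auto simp: d_election_algorithm_def exact_d_election_algorithm_def not_solves_election)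

end
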